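(* Suppose that assumptions (FS1), (FS2), (SS1) and (VA1) (written out in the context) hold. Then the Horvitz–Thompson estimator is design-unbiased, i.e. $E(\hat\tau_\rho)=\tau_\rho$. Moreover, along the asymptotic sequence described in the context, $$E\left(\left[A^{-1}\{\hat\tau_\rho-\tau_\rho\}\right]^2\right)=O(n_I^{-1})\qquad\text{and}\qquad \frac{\hat\tau_\rho}{\tau_\rho}\longrightarrow 1\ \text{ in probability.}$$
   Context: Setting. $\mathcal F\subset\mathbb R^d$ is a fixed bounded measurable set of Lebesgue measure $A>0$, and $\rho:\mathcal F\to\mathbb R$ is Lebesgue integrable, with $\tau_\rho=\int_{\mathcal F}\rho(x)\,dx$. We consider a sequence (index suppressed) of partitions of $\mathcal F$ into $N_I$ disjoint measurable sub-regions (primary sampling units, PSUs) forming $U_I=\{u_1,\dots,u_{N_I}\}$; $A_i$ is the measure of $u_i$. Asymptotics: $A$ is fixed, $N_I\to\infty$, the partition becomes increasingly fine (PSU diameters shrink to $0$), and $n_I\to\infty$. Constants in the assumptions do not depend on the position in the sequence; $O(\cdot)$ and limits are along this sequence. Sampling. First stage: a random sample $S_I\subset U_I$ of size $n_I$ is selected; $I_{Ii}$ is the indicator of $u_i\in S_I$ and $\pi_{Ii}=E(I_{Ii})$. Second stage: conditionally on $S_I$, for each $u_i\in S_I$ a sample $S_{IIi}$ of $n_{IIi}$ points is drawn independently from a probability density $f_{IIi}$ supported on $u_i$; the second-stage mechanism does not depend on the realization of $S_I$, and the samples $S_{IIi}$ are conditionally independent across PSUs given $S_I$. Put $\pi_{IIi}(x)=n_{IIi}f_{IIi}(x)$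 and $n_{II0}=N_I^{-1}\sum_{i=1}^{N_I}n_{IIi}$. Estimator. $\hat\tau_{\rho i}=\sum_{x\in S_{IIi}}\rho(x)/\pi_{IIi}(x)$ and the Horvitz–Thompson estimator is $\hat\tau_\rho=\sum_{u_i\in S_I}\hat\tau_{\rho i}/\pi_{Ii}$. Expectations are with respect to the two-stage sampling. Assumptions. (FS1) There exist constants $f_{I0}<1$ and $0<c_{I1}\le C_{I1}<\infty$ with $n_I/N_I\le f_{I0}$ and $c_{I1}\le (N_I/n_I)\pi_{Ii}\le C_{I1}$ for all $i$. (FS2) There exist constants $C_{I2},C_{I3},C_{I4}>0$ such that, the maxima being over distinct indices in $\{1,\dots,N_I\}$, $\Delta_{I2}=\max|E\{(I_{Ii}-\pi_{Ii})(I_{Ij}-\pi_{Ij})\}|\le C_{I2}N_I^{-2}n_I$, $\Delta_{I3}=\max|E\{(I_{Ii}-\pi_{Ii})(I_{Ij}-\pi_{Ij})(I_{Ii'}-\pi_{Ii'})\}|\le C_{I3}N_I^{-3}n_I^2$, $\Delta_{I4}=\max|E\{(I_{Ii}-\pi_{Ii})(I_{Ij}-\pi_{Ij})(I_{Ii'}-\pi_{Ii'})(I_{Ij'}-\pi_{Ij'})\}|\le C_{I4}N_I^{-4}n_I^2$. (SS1) There exist constants $0<\lambda_1\le\Lambda_1<\infty$, $0<\phi_1\le\Phi_1<\infty$, $0<c_1\le C_1<\infty$ such that for every PSU $u_i$: $\lambda_1n_{II0}\le n_{IIi}\le\Lambda_1n_{II0}$; $\phi_1A/N_I\le A_i\le\Phi_1A/N_I$;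 $c_1/A_i\le f_{IIi}(x)\le C_1/A_i$ for all $x\in u_i$; and $n_{IIi}\ge2$. (VA1) There exist constants $m_1,M_1$ such that $A^{-1}\int_{\mathcal F}\rho(x)^4dx\le M_1$ and $|A^{-1}\int_{\mathcal F}\rho(x)\,dx|\ge m_1>0$. *)

theory Defs
  imports "HOL-Probability.Probability" "HOL-Library.Landau_Symbols"
begin

(* One position in the asymptotic sequence.  PSUs are numbered 1..N_I, and `point d i k w` is the
   k-th (k < n_II i) point sampled in PSU i under outcome w.  It is meaningful only for
   i in S_I d w; its values for unselected PSUs are arbitrary. *)
record ('a, 'w) design =
  N_I :: nat
  n_I :: nat
  psu :: "nat \<Rightarrow> 'a set"
  n_II :: "nat \<Rightarrow> nat"
  f_II :: "nat \<Rightarrow> 'a \<Rightarrow> real"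
  pspace :: "'w measure"
  S_I :: "'w \<Rightarrow> nat set"
  point :: "nat \<Rightarrow> nat \<Rightarrow> 'w \<Rightarrow> 'a"

definition psu_partition :: "'a::euclidean_space set \<Rightarrow> ('a, 'w) design \<Rightarrow> bool" where
  "psu_partition F d \<longleftrightarrow>
     (\<Union>i\<in>{1..N_I d}. psu d i) = F \<and>
     disjoint_family_on (psu d) {1..N_I d} \<and>
     (\<forall>i\<in>{1..N_I d}. psu d i \<in> sets lebesgue)"

definition first_stage :: "('a, 'w) design \<Rightarrow> bool" where
  "first_stage d \<longleftrightarrow>
     prob_space (pspace d) \<and>
     S_I d \<in> measurable (pspace d) (count_space (Pow {1..N_I d})) \<and>
     (\<forall>w\<in>space (pspace d). card (S_I d w) = n_I d)"

definition second_stage_densities :: "('a::euclidean_space, 'w) design \<Rightarrow> bool" where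
  "second_stage_densities d \<longleftrightarrow>
     (\<forall>i\<in>{1..N_I d}.
        f_II d i \<in> borel_measurable lebesgue \<and>
        (\<forall>x. 0 \<le> f_II d i x) \<and>
        (\<forall>x. x \<notin> psu d i \<longrightarrow> f_II d i x = 0) \<and>
        (\<integral>\<^sup>+x. ennreal (f_II d i x) \<partial>lebesgue) = 1)"

definition given_sample :: "('a, 'w) design \<Rightarrow> nat set \<Rightarrow> 'w measure" where
  "given_sample d s = uniform_measure (pspace d) {w \<in> space (pspace d). S_I d w = s}"

(* Given S_I = s, all points of all selected PSUs are jointly independent; this covers both the
   independence within each PSU and the conditional independence across PSUs.  That the second
   stage does not depend on the realization of S_I is expressed by n_II and f_II not depending
   on s. *)
definition second_stage :: "('a::euclidean_space, 'w) design \<Rightarrow> bool" where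
  "second_stage d \<longleftrightarrow>
     (\<forall>s. measure (pspace d) {w \<in> space (pspace d). S_I d w = s} > 0 \<longrightarrow>
        prob_space.indep_vars (given_sample d s) (\<lambda>_. lebesgue)
          (\<lambda>(i, k). point d i k) (SIGMA i:s. {..<n_II d i}) \<and>
        (\<forall>i\<in>s. \<forall>k<n_II d i.
           distributed (given_sample d s) lebesgue (point d i k) (\<lambda>x. ennreal (f_II d i x))))"

definition two_stage_sampling :: "'a::euclidean_space set \<Rightarrow> ('a, 'w) design \<Rightarrow> bool" where
  "two_stage_sampling F d \<longleftrightarrow>
     psu_partition F d \<and> first_stage d \<and> second_stage_densities d \<and> second_stage d"

definition I_I :: "('a, 'w) design \<Rightarrow> nat \<Rightarrow> 'w \<Rightarrow> real" where
  "I_I d i w = indicator (S_I d w) i"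

definition pi_I :: "('a, 'w) design \<Rightarrow> nat \<Rightarrow> real" where
  "pi_I d i = (\<integral>w. I_I d i w \<partial>pspace d)"

definition pi_II :: "('a, 'w) design \<Rightarrow> nat \<Rightarrow> 'a \<Rightarrow> real" where
  "pi_II d i x = real (n_II d i) * f_II d i x"

definition n_II0 :: "('a, 'w) design \<Rightarrow> real" where
  "n_II0 d = (\<Sum>i\<in>{1..N_I d}. real (n_II d i)) / real (N_I d)"

definition F_total :: "'a::euclidean_space set \<Rightarrow> ('a \<Rightarrow> real) \<Rightarrow> real" where
  "F_total F \<rho> = (LINT x:F|lebesgue. \<rho> x)"

definition psu_estimator :: "('a \<Rightarrow> real) \<Rightarrow> ('a, 'w) design \<Rightarrow> nat \<Rightarrow> 'w \<Rightarrow> real" where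
  "psu_estimator \<rho> d i w = (\<Sum>k<n_II d i. \<rho> (point d i k w) / pi_II d i (point d i k w))"

definition HT :: "('a \<Rightarrow> real) \<Rightarrow> ('a, 'w) design \<Rightarrow> 'w \<Rightarrow> real" where
  "HT \<rho> d w = (\<Sum>i\<in>S_I d w. psu_estimator \<rho> d i w / pi_I d i)"

(* Asymptotic frame; along the sequence F, and hence its measure, is fixed. *)
definition asymptotic_frame :: "(nat \<Rightarrow> ('a::euclidean_space, 'w) design) \<Rightarrow> bool" where
  "asymptotic_frame D \<longleftrightarrow>
     filterlim (\<lambda>\<nu>. N_I (D \<nu>)) at_top sequentially \<and>
     filterlim (\<lambda>\<nu>. n_I (D \<nu>)) at_top sequentially \<and>
     (\<lambda>\<nu>. MAX i\<in>{1..N_I (D \<nu>)}. diameter (psu (D \<nu>) i)) \<longlonglongrightarrow> 0"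

(* Maximal absolute central product moment of the inclusion indicators over k distinct PSUs.
   The product is symmetric, so k distinct indices are given as a k-element set.  The inserted 0
   fixes the value when N_I < k and does not affect the maximum otherwise. *)
definition Delta_I :: "nat \<Rightarrow> ('a, 'w) design \<Rightarrow> real" where
  "Delta_I k d = Max (insert 0
     ((\<lambda>J. \<bar>\<integral>w. (\<Prod>i\<in>J. (I_I d i w - pi_I d i)) \<partial>pspace d\<bar>) ` {J. J \<subseteq> {1..N_I d} \<and> card J = k}))"

definition FS1 :: "(nat \<Rightarrow> ('a, 'w) design) \<Rightarrow> bool" where
  "FS1 D \<longleftrightarrow>
     (\<exists>f0 c1 C1 :: real. f0 < 1 \<and> 0 < c1 \<and> c1 \<le> C1 \<and>
        (\<forall>\<nu>. real (n_I (D \<nu>)) / real (N_I (D \<nu>)) \<le> f0 \<and>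
           (\<forall>i\<in>{1..N_I (D \<nu>)}.
              c1 \<le> real (N_I (D \<nu>)) / real (n_I (D \<nu>)) * pi_I (D \<nu>) i \<and>
              real (N_I (D \<nu>)) / real (n_I (D \<nu>)) * pi_I (D \<nu>) i \<le> C1)))"

definition FS2 :: "(nat \<Rightarrow> ('a, 'w) design) \<Rightarrow> bool" where
  "FS2 D \<longleftrightarrow>
     (\<exists>C2 C3 C4 :: real. 0 < C2 \<and> 0 < C3 \<and> 0 < C4 \<and>
        (\<forall>\<nu>. Delta_I 2 (D \<nu>) \<le> C2 * real (n_I (D \<nu>)) / real (N_I (D \<nu>)) ^ 2 \<and>
             Delta_I 3 (D \<nu>) \<le> C3 * real (n_I (D \<nu>)) ^ 2 / real (N_I (D \<nu>)) ^ 3 \<and>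
             Delta_I 4 (D \<nu>) \<le> C4 * real (n_I (D \<nu>)) ^ 2 / real (N_I (D \<nu>)) ^ 4))"

definition SS1 :: "'a::euclidean_space set \<Rightarrow> (nat \<Rightarrow> ('a, 'w) design) \<Rightarrow> bool" where
  "SS1 F D \<longleftrightarrow>
     (\<exists>l1 L1 p1 P1 c1 C1 :: real.
        0 < l1 \<and> l1 \<le> L1 \<and> 0 < p1 \<and> p1 \<le> P1 \<and> 0 < c1 \<and> c1 \<le> C1 \<and>
        (\<forall>\<nu>. \<forall>i\<in>{1..N_I (D \<nu>)}.
           l1 * n_II0 (D \<nu>) \<le> real (n_II (D \<nu>) i) \<and>
           real (n_II (D \<nu>) i) \<le> L1 * n_II0 (D \<nu>) \<and>
           p1 * measure lebesgue F / real (N_I (D \<nu>)) \<le> measure lebesgue (psu (D \<nu>) i) \<and>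
           measure lebesgue (psu (D \<nu>) i) \<le> P1 * measure lebesgue F / real (N_I (D \<nu>)) \<and>
           (\<forall>x\<in>psu (D \<nu>) i.
              c1 / measure lebesgue (psu (D \<nu>) i) \<le> f_II (D \<nu>) i x \<and>
              f_II (D \<nu>) i x \<le> C1 / measure lebesgue (psu (D \<nu>) i)) \<and>
           2 \<le> n_II (D \<nu>) i))"

(* A Bochner integral is 0 for non-integrable functions, so finiteness of the fourth moment
   has to be stated separately. *)
definition VA1 :: "'a::euclidean_space set \<Rightarrow> ('a \<Rightarrow> real) \<Rightarrow> bool" where
  "VA1 F \<rho> \<longleftrightarrow>
     (\<exists>m1 M1 :: real. 0 < m1 \<and>
        set_integrable lebesgue F (\<lambda>x. \<rho> x ^ 4) \<and>
        (LINT x:F|lebesgue. \<rho> x ^ 4) / measure lebesgue F \<le> M1 \<and>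
        m1 \<le> \<bar>(LINT x:F|lebesgue. \<rho> x) / measure lebesgue F\<bar>)"

(* The probability space may change along the sequence. *)
definition converges_in_probability ::
  "(nat \<Rightarrow> 'w measure) \<Rightarrow> (nat \<Rightarrow> 'w \<Rightarrow> real) \<Rightarrow> real \<Rightarrow> bool" where
  "converges_in_probability M Z c \<longleftrightarrow>
     (\<forall>\<nu>. Z \<nu> \<in> borel_measurable (M \<nu>)) \<and>
     (\<forall>e>0. (\<lambda>\<nu>. measure (M \<nu>) {w \<in> space (M \<nu>). \<bar>Z \<nu> w - c\<bar> > e}) \<longlonglongrightarrow> 0)"

end

theory Submission
  imports Defs
begin

text \<open>
  Condition on the first-stage sample \<open>s\<close>. Given \<open>s\<close>, the estimator is a sum of independent terms
  with mean \<open>\<Sum>i\<in>s. \<tau> i / \<pi> i\<close>, where \<open>\<tau> i\<close> is the integral of \<open>\<rho>\<close> over PSU \<open>i\<close>. Averaging over \<open>s\<close>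
  gives unbiasedness, and the mean square error splits into the averaged conditional variance and
  the mean square error of \<open>\<Sum>i\<in>s. \<tau> i / \<pi> i\<close>. Since \<open>f i\<close> is at least a multiple \<open>a\<close> of \<open>N_I / A\<close>,
  both the variance of a PSU estimator and \<open>(\<tau> i)\<^sup>2\<close> are at most \<open>1 / a\<close> times the integral of \<open>\<rho>\<^sup>2\<close>
  over the PSU. Together with \<open>\<pi> i \<ge> c n_I / N_I\<close> and the bound on \<open>\<Delta>\<^sub>I\<^sub>2\<close> this makes both parts
  \<open>O(1 / n_I)\<close>, and Chebyshev's inequality yields the convergence in probability.
\<close>

section \<open>Conditioning on an event and on a finite-valued variable\<close>

text \<open>The uniform measure on \<open>A\<close> has density
  \<open>indicator A x / measure M A\<close>, so both claims are a change of density. The product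
  form of the second one suits the sum over samples in the law of total expectation.\<close>

lemma (in finite_measure) uniform_measure_integral:
  fixes f :: "'a \<Rightarrow> real"
  assumes [measurable]: "A \<in> sets M" "f \<in> borel_measurable M" and A: "measure M A > 0"
  shows integrable_uniform_measure_iff:
      "integrable (uniform_measure M A) f \<longleftrightarrow> integrable M (\<lambda>x. indicator A x * f x)"
    and integral_uniform_measure:
      "measure M A * (\<integral>x. f x \<partial>uniform_measure M A) = (\<integral>x. indicator A x * f x \<partial>M)"
proof -
  have eq: "uniform_measure M A = density M (\<lambda>x. ennreal (indicator A x / measure M A))"
    unfolding uniform_measure_def
    by (rule arg_cong[where f = "density M"]) (use A in
      \<open>auto simp: emeasure_eq_measure divide_ennreal indicator_def simp flip: ennreal_1\<close>)
  have "integrable (uniform_measure M A) f \<longleftrightarrow>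
      integrable M (\<lambda>x. (1 / measure M A) * (indicator A x * f x))"
    unfolding eq using A by (subst integrable_density) auto
  then show "integrable (uniform_measure M A) f \<longleftrightarrow> integrable M (\<lambda>x. indicator A x * f x)"
    using A by (subst (asm) integrable_mult_left_iff) auto
  have "(\<integral>x. f x \<partial>uniform_measure M A) =
      (\<integral>x. (1 / measure M A) * (indicator A x * f x) \<partial>M)"
    unfolding eq using A by (subst integral_density) auto
  then show "measure M A * (\<integral>x. f x \<partial>uniform_measure M A) = (\<integral>x. indicator A x * f x \<partial>M)"
    using A by simp
qed

text \<open>Law of total expectation: the expectation splits over the finitely many events
  \<open>S w = s\<close>, and those of probability zero contribute nothing. Measurability of the
  diagonal \<open>Z (S w) w\<close> is a separate assumption because \<open>cond\<close> says
  nothing about \<open>Z s\<close> when \<open>s\<close> has probability zero.\<close>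

lemma (in prob_space) conditioning_on_finite:
  fixes Z :: "'b \<Rightarrow> 'a \<Rightarrow> real" and h :: "'b \<Rightarrow> real"
  assumes S[measurable]: "S \<in> measurable M (count_space T)" and "finite T"
    and meas: "(\<lambda>w. Z (S w) w) \<in> borel_measurable M"
    and cond: "\<And>s. s \<in> T \<Longrightarrow> prob {w \<in> space M. S w = s} > 0 \<Longrightarrow>
      integrable (uniform_measure M {w \<in> space M. S w = s}) (Z s)"
  shows integrable_conditioning: "integrable M (\<lambda>w. Z (S w) w)"
    and expectation_conditioning:
      "(\<And>s. s \<in> T \<Longrightarrow> prob {w \<in> space M. S w = s} > 0 \<Longrightarrow>
        (\<integral>w. Z s w \<partial>uniform_measure M {w \<in> space M. S w = s}) = h s) \<Longrightarrow>
        expectation (\<lambda>w. Z (S w) w) = expectation (\<lambda>w. h (S w))"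
    and expectation_conditioning_le:
      "(\<And>s. s \<in> T \<Longrightarrow> prob {w \<in> space M. S w = s} > 0 \<Longrightarrow>
        (\<integral>w. Z s w \<partial>uniform_measure M {w \<in> space M. S w = s}) \<le> h s) \<Longrightarrow>
        expectation (\<lambda>w. Z (S w) w) \<le> expectation (\<lambda>w. h (S w))"
proof -
  define E where "E s = {w \<in> space M. S w = s}" for s
  have E[measurable]: "E s \<in> events" if "s \<in> T" for s
    using measurable_sets[OF S, of "{s}"] that by (simp add: E_def vimage_def Int_def conj_commute)
  have split: "f (S w) w = (\<Sum>s\<in>T. indicator (E s) w * f s w)"
    if "w \<in> space M" for f :: "'b \<Rightarrow> 'a \<Rightarrow> real" and w
  proof -
    have "S w \<in> T"
      using measurable_space[OF S that] by simp
    then have "(\<Sum>s\<in>T. indicator (E s) w * f s w) = (\<Sum>s\<in>T. if s = S w then f s w else 0)"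
      using that by (intro sum.cong) (auto simp: E_def)
    then show ?thesis
      using \<open>finite T\<close> \<open>S w \<in> T\<close> by simp
  qed
  \<comment> \<open>On \<open>E s\<close> the function \<open>Z s\<close> agrees with the measurable
    diagonal, so the truncated function is measurable even if \<open>E s\<close> is null.\<close>
  have pm: "(\<lambda>w. indicator (E s) w * Z s w) \<in> borel_measurable M" if "s \<in> T" for s
  proof -
    have "(\<lambda>w. indicator (E s) w * Z (S w) w) \<in> borel_measurable M"
      using E[OF that] meas by measurable
    also have "(\<lambda>w. indicator (E s) w * Z (S w) w) = (\<lambda>w. indicator (E s) w * Z s w)"
      by (auto simp: E_def indicator_def)
    finally show ?thesis .
  qed
  have piece: "integrable M (\<lambda>w. indicator (E s) w * Z s w) \<and>
      expectation (\<lambda>w. indicator (E s) w * Z s w) =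
        prob (E s) * (\<integral>w. Z s w \<partial>uniform_measure M (E s))" if s: "s \<in> T" for s
  proof (cases "prob (E s) > 0")
    case True
    then have i: "integrable (uniform_measure M (E s)) (Z s)"
      using cond s by (simp add: E_def)
    then have "Z s \<in> borel_measurable M"
      by (auto dest: borel_measurable_integrable)
    with i True s show ?thesis
      using integrable_uniform_measure_iff[of "E s" "Z s"] integral_uniform_measure[of "E s" "Z s"]
      by simp
  next
    case False
    then have p0: "prob (E s) = 0"
      using measure_nonneg[of M "E s"] by linarith
    then have "AE w in M. w \<notin> E s"
      using prob_eq_0[OF E[OF s]] by simp
    then have z: "AE w in M. indicator (E s) w * Z s w = 0"
      by eventually_elim simp
    have "integrable M (\<lambda>w. indicator (E s) w * Z s w)"
      using integrable_cong_AE[OF pm[OF s] _ z] by simp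
    then show ?thesis
      using integral_eq_zero_AE[OF z] p0 by simp
  qed
  show "integrable M (\<lambda>w. Z (S w) w)"
    using piece by (subst Bochner_Integration.integrable_cong[OF refl split]) auto
  have EZ: "expectation (\<lambda>w. Z (S w) w) =
      (\<Sum>s\<in>T. prob (E s) * (\<integral>w. Z s w \<partial>uniform_measure M (E s)))"
    using piece by (subst Bochner_Integration.integral_cong[OF refl split]) auto
  have Eh: "expectation (\<lambda>w. h (S w)) = (\<Sum>s\<in>T. prob (E s) * h s)"
  proof -
    have "integrable M (\<lambda>w. indicator (E s) w * h s)"
        "expectation (\<lambda>w. indicator (E s) w * h s) = prob (E s) * h s" if "s \<in> T" for s
      using E[OF that] by (simp_all add: Int_absorb2 sets.sets_into_space less_top[symmetric])
    then show ?thesis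
      by (subst Bochner_Integration.integral_cong[OF refl split[of _ "\<lambda>s _. h s"]]) auto
  qed
  show "expectation (\<lambda>w. Z (S w) w) = expectation (\<lambda>w. h (S w))"
    if "\<And>s. s \<in> T \<Longrightarrow> prob {w \<in> space M. S w = s} > 0 \<Longrightarrow>
        (\<integral>w. Z s w \<partial>uniform_measure M {w \<in> space M. S w = s}) = h s"
    unfolding EZ Eh
  proof (intro sum.cong refl)
    fix s assume "s \<in> T"
    then show "prob (E s) * (\<integral>w. Z s w \<partial>uniform_measure M (E s)) = prob (E s) * h s"
      using that[of s] by (cases "prob (E s) > 0") (auto simp: E_def zero_less_measure_iff)
  qed
  show "expectation (\<lambda>w. Z (S w) w) \<le> expectation (\<lambda>w. h (S w))"
    if "\<And>s. s \<in> T \<Longrightarrow> prob {w \<in> space M. S w = s} > 0 \<Longrightarrow>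
        (\<integral>w. Z s w \<partial>uniform_measure M {w \<in> space M. S w = s}) \<le> h s"
    unfolding EZ Eh
  proof (intro sum_mono)
    fix s assume "s \<in> T"
    then show "prob (E s) * (\<integral>w. Z s w \<partial>uniform_measure M (E s)) \<le> prob (E s) * h s"
      using that[of s] by (cases "prob (E s) > 0") (auto simp: E_def zero_less_measure_iff)
  qed
qed

section \<open>Sums of independent square-integrable variables\<close>

text \<open>Induction on \<open>I\<close>: the new summand is independent of the sum of the others,
  so the expectation of the cross term factorises and cancels in the variance.\<close>

lemma (in prob_space) indep_sum_second_moment:
  fixes X :: "'i \<Rightarrow> 'a \<Rightarrow> real"
  assumes "finite I" "indep_vars (\<lambda>_. borel) X I"
    and "\<And>i. i \<in> I \<Longrightarrow> integrable M (\<lambda>w. (X i w)\<^sup>2)"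
  shows integrable_indep_sum_square: "integrable M (\<lambda>w. (\<Sum>i\<in>I. X i w)\<^sup>2)"
    and variance_indep_sum: "variance (\<lambda>w. \<Sum>i\<in>I. X i w) = (\<Sum>i\<in>I. variance (X i))"
proof -
  have "integrable M (\<lambda>w. (\<Sum>i\<in>I. X i w)\<^sup>2) \<and>
    variance (\<lambda>w. \<Sum>i\<in>I. X i w) = (\<Sum>i\<in>I. variance (X i))"
    using assms
  proof (induction I rule: finite_induct)
    case (insert x I)
    let ?T = "\<lambda>w. \<Sum>i\<in>I. X i w"
    have rv: "random_variable borel (X i)" if "i \<in> insert x I" for i
      using insert.prems(1) that by (auto simp: indep_vars_def2)
    have int: "integrable M (X i)" if "i \<in> insert x I" for i
      using square_integrable_imp_integrable[OF rv insert.prems(2)] that by simp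
    have "indep_vars (\<lambda>_. borel) X I"
      using insert.prems(1) by (rule indep_vars_subset) auto
    then have IH: "integrable M (\<lambda>w. (?T w)\<^sup>2)" "variance ?T = (\<Sum>i\<in>I. variance (X i))"
      using insert.IH insert.prems(2) by auto
    have intT: "integrable M ?T"
      using int by auto
    have ind: "indep_var borel (X x) borel ?T"
      using insert.hyps insert.prems(1) by (intro indep_vars_sum) auto
    note prod = indep_var_integrable[OF ind int[OF insertI1] intT]
      indep_var_lebesgue_integral[OF ind int[OF insertI1] intT]
    have sq: "(\<Sum>i\<in>insert x I. X i w)\<^sup>2 = (X x w)\<^sup>2 + 2 * (X x w * ?T w) + (?T w)\<^sup>2" for w
      using insert.hyps by (simp add: power2_sum algebra_simps)
    have i2: "integrable M (\<lambda>w. (\<Sum>i\<in>insert x I. X i w)\<^sup>2)"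
      unfolding sq using prod(1) IH(1) insert.prems(2)[OF insertI1] by auto
    have "variance (\<lambda>w. \<Sum>i\<in>insert x I. X i w) = variance (X x) + variance ?T"
    proof -
      have "expectation (\<lambda>w. (\<Sum>i\<in>insert x I. X i w)\<^sup>2) =
          expectation (\<lambda>w. (X x w)\<^sup>2) + 2 * (expectation (X x) * expectation ?T) + expectation (\<lambda>w. (?T w)\<^sup>2)"
        unfolding sq using prod IH(1) insert.prems(2)[OF insertI1] by simp
      moreover have "expectation (\<lambda>w. \<Sum>i\<in>insert x I. X i w) = expectation (X x) + expectation ?T"
        using insert.hyps int intT by (simp del: Bochner_Integration.integral_sum)
      moreover have "integrable M (\<lambda>w. \<Sum>i\<in>insert x I. X i w)"
        using int by auto
      ultimately show ?thesis
        using variance_eq[OF _ i2] variance_eq[OF intT IH(1)]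
          variance_eq[OF int[OF insertI1] insert.prems(2)[OF insertI1]]
        by (simp add: power2_sum algebra_simps del: Bochner_Integration.integral_sum)
    qed
    then show ?case
      using i2 IH(2) insert.hyps by simp
  qed simp
  then show "integrable M (\<lambda>w. (\<Sum>i\<in>I. X i w)\<^sup>2)"
    "variance (\<lambda>w. \<Sum>i\<in>I. X i w) = (\<Sum>i\<in>I. variance (X i))"
    by auto
qed

lemma (in prob_space) second_moment_about:
  fixes X :: "'a \<Rightarrow> real"
  assumes "integrable M X" "integrable M (\<lambda>w. (X w)\<^sup>2)"
  shows "expectation (\<lambda>w. (X w - c)\<^sup>2) = variance X + (expectation X - c)\<^sup>2"
  using assms by (simp add: variance_eq power2_diff algebra_simps prob_space power2_eq_square)

section \<open>Weighting by an inverse density\<close>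

text \<open>
  Outside \<open>U\<close> the quotient is \<open>\<rho> x / 0 = 0\<close>, even where \<open>\<rho>\<close> is an arbitrary function.
\<close>

lemma borel_measurable_inverse_density:
  fixes f \<rho> :: "'b \<Rightarrow> real"
  assumes [measurable]: "f \<in> borel_measurable N" and "\<And>x. x \<notin> U \<Longrightarrow> f x = 0"
    and "set_integrable N U \<rho>"
  shows "(\<lambda>x. \<rho> x / f x) \<in> borel_measurable N"
proof -
  have [measurable]: "(\<lambda>x. indicator U x *\<^sub>R \<rho> x) \<in> borel_measurable N"
    using assms(3) by (auto simp: set_integrable_def)
  have "(\<lambda>x. \<rho> x / f x) = (\<lambda>x. (indicator U x *\<^sub>R \<rho> x) / f x)"
    using assms(2) by (auto simp: fun_eq_iff indicator_def)
  then show ?thesis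
    using assms(1) by (simp only:) measurable
qed

text \<open>Integrating against the law of \<open>X\<close> multiplies by \<open>f\<close>, which
  cancels one denominator. The first moment reduces to the integral of \<open>\<rho>\<close>, the
  second to that of \<open>(\<rho> x)\<^sup>2 / f x\<close> over \<open>U\<close>, where
  \<open>f\<close> is at least \<open>a\<close>.\<close>

lemma inverse_density_weighting:
  fixes f \<rho> :: "'b \<Rightarrow> real"
  assumes X: "distributed M N X (\<lambda>x. ennreal (f x))"
    and f: "f \<in> borel_measurable N" "\<And>x. 0 \<le> f x" "\<And>x. x \<notin> U \<Longrightarrow> f x = 0"
    and a: "0 < a" "\<And>x. x \<in> U \<Longrightarrow> a \<le> f x"
    and \<rho>: "set_integrable N U \<rho>" "set_integrable N U (\<lambda>x. (\<rho> x)\<^sup>2)"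
  shows expectation_inverse_density_weighting:
      "(\<integral>w. \<rho> (X w) / f (X w) \<partial>M) = (LINT x:U|N. \<rho> x)"
    and integrable_inverse_density_weighting_square:
      "integrable M (\<lambda>w. (\<rho> (X w) / f (X w))\<^sup>2)"
    and inverse_density_weighting_square_le:
      "(\<integral>w. (\<rho> (X w) / f (X w))\<^sup>2 \<partial>M) \<le> (LINT x:U|N. (\<rho> x)\<^sup>2) / a"
proof -
  define g where "g x = \<rho> x / f x" for x
  have gm[measurable]: "g \<in> borel_measurable N"
    unfolding g_def by (rule borel_measurable_inverse_density[OF f(1,3) \<rho>(1)])
  have Xm[measurable]: "X \<in> measurable M N"
    using X by (rule distributed_measurable)
  \<comment> \<open>On \<open>U\<close> the bound by \<open>a\<close> makes \<open>f\<close> nonzero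
    and the cancellation valid; outside \<open>U\<close> both sides vanish.\<close>
  have fg: "f x * g x = indicator U x *\<^sub>R \<rho> x" for x
    using f(3)[of x] a(1) a(2)[of x] by (auto simp: g_def indicator_def)
  show "(\<integral>w. \<rho> (X w) / f (X w) \<partial>M) = (LINT x:U|N. \<rho> x)"
    using distributed_integral[OF X gm f(2)] unfolding fg unfolding set_lebesgue_integral_def g_def
    by (rule sym)
  have i: "integrable N (\<lambda>x. indicator U x *\<^sub>R (\<rho> x)\<^sup>2 / a)"
    using \<rho>(2) by (simp add: set_integrable_def)
  have le: "f x * (g x)\<^sup>2 \<le> indicator U x *\<^sub>R (\<rho> x)\<^sup>2 / a" for x
  proof (cases "x \<in> U")
    case True
    then have "0 < a" "a \<le> f x" using a by auto
    moreover have "f x * (g x)\<^sup>2 = (\<rho> x)\<^sup>2 / f x"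
      using calculation by (simp add: g_def power2_eq_square)
    ultimately show ?thesis
      using True by (simp add: frac_le)
  qed (use f(3) in auto)
  have i2: "integrable N (\<lambda>x. f x * (g x)\<^sup>2)"
    by (rule Bochner_Integration.integrable_bound[OF i])
      (use f(1,2) le a(1) in \<open>auto simp: abs_mult intro!: AE_I2\<close>)
  then show "integrable M (\<lambda>w. (\<rho> (X w) / f (X w))\<^sup>2)"
    using distributed_integrable[OF X borel_measurable_power[OF gm] f(2), of 2] by (simp add: g_def)
  have "(\<integral>w. (g (X w))\<^sup>2 \<partial>M) = (\<integral>x. f x * (g x)\<^sup>2 \<partial>N)"
    by (rule distributed_integral[OF X _ f(2), symmetric]) auto
  also have "\<dots> \<le> (\<integral>x. indicator U x *\<^sub>R (\<rho> x)\<^sup>2 / a \<partial>N)"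
    by (rule integral_mono[OF i2 i le])
  finally show "(\<integral>w. (\<rho> (X w) / f (X w))\<^sup>2 \<partial>M) \<le> (LINT x:U|N. (\<rho> x)\<^sup>2) / a"
    by (simp add: g_def set_lebesgue_integral_def)
qed

section \<open>A single two-stage design\<close>

text \<open>The design is fixed here. All estimates are expressed through the lower bounds
  \<open>a\<close> for the densities and \<open>p\<close> for the inclusion probabilities, which are
  allowed to vary along the sequence later.\<close>

locale two_stage_estimation =
  fixes F :: "'a::euclidean_space set" and \<rho> :: "'a \<Rightarrow> real"
    and d :: "('a, 'w) design" and a p :: real
  assumes sampling: "two_stage_sampling F d"
    and integrable: "set_integrable lebesgue F \<rho>" "set_integrable lebesgue F (\<lambda>x. (\<rho> x)\<^sup>2)"
    and p: "0 < p" "\<And>i. i \<in> {1..N_I d} \<Longrightarrow> p \<le> pi_I d i"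
    and a: "0 < a" "\<And>i x. i \<in> {1..N_I d} \<Longrightarrow> x \<in> psu d i \<Longrightarrow> a \<le> f_II d i x"
    and n_II: "\<And>i. i \<in> {1..N_I d} \<Longrightarrow> 0 < n_II d i"
begin

abbreviation "\<tau> i \<equiv> (LINT x:psu d i|lebesgue. \<rho> x)"
abbreviation "\<sigma> i \<equiv> (LINT x:psu d i|lebesgue. (\<rho> x)\<^sup>2)"
abbreviation "selected s \<equiv> {w \<in> space (pspace d). S_I d w = s}"

text \<open>The sample is a parameter because conditioning needs one random variable for each value
  \<open>s\<close> of \<open>S_I\<close>; the estimator itself is the diagonal
  \<open>HT_of (S_I d w) w\<close>.\<close>

definition HT_of :: "nat set \<Rightarrow> 'w \<Rightarrow> real" where
  "HT_of s w = (\<Sum>i\<in>s. psu_estimator \<rho> d i w / pi_I d i)"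

sublocale prob_space "pspace d"
  using sampling by (simp add: two_stage_sampling_def first_stage_def)

lemma S_I_measurable: "S_I d \<in> measurable (pspace d) (count_space (Pow {1..N_I d}))"
  using sampling by (simp add: two_stage_sampling_def first_stage_def)

lemma selected_event: "s \<subseteq> {1..N_I d} \<Longrightarrow> selected s \<in> events"
  using measurable_sets[OF S_I_measurable, of "{s}"] by (simp add: vimage_def Int_def conj_commute)

lemma possible_sample_subset: "0 < prob (selected s) \<Longrightarrow> s \<subseteq> {1..N_I d}"
proof (rule ccontr)
  assume "0 < prob (selected s)" and "\<not> s \<subseteq> {1..N_I d}"
  then have "selected s = {}"
    using measurable_space[OF S_I_measurable] by auto
  with \<open>0 < prob (selected s)\<close> show False
    by simp
qed

lemma given_sample_prob_space: "0 < prob (selected s) \<Longrightarrow> prob_space (given_sample d s)"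
  unfolding given_sample_def
  by (rule prob_space_uniform_measure) (auto simp: emeasure_eq_measure)

lemma set_integrable_psu:
  assumes "i \<in> {1..N_I d}"
  shows "set_integrable lebesgue (psu d i) \<rho>" "set_integrable lebesgue (psu d i) (\<lambda>x. (\<rho> x)\<^sup>2)"
proof -
  have "psu d i \<in> sets lebesgue" "psu d i \<subseteq> F"
    using sampling assms by (auto simp: two_stage_sampling_def psu_partition_def)
  then show "set_integrable lebesgue (psu d i) \<rho>" "set_integrable lebesgue (psu d i) (\<lambda>x. (\<rho> x)\<^sup>2)"
    using integrable set_integrable_subset by blast+
qed

lemma sum_psu_integral:
  assumes "set_integrable lebesgue F g"
  shows "(\<Sum>i\<in>{1..N_I d}. LINT x:psu d i|lebesgue. g x) = (LINT x:F|lebesgue. (g x :: real))"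
proof -
  have part: "(\<Union>i\<in>{1..N_I d}. psu d i) = F" "disjoint_family_on (psu d) {1..N_I d}"
      "\<And>i. i \<in> {1..N_I d} \<Longrightarrow> psu d i \<in> sets lebesgue"
    using sampling by (auto simp: two_stage_sampling_def psu_partition_def)
  have "set_integrable lebesgue (psu d i) g" if "i \<in> {1..N_I d}" for i
    by (rule set_integrable_subset[OF assms]) (use part that in auto)
  then have "(LINT x:(\<Union>i\<in>{1..N_I d}. psu d i)|lebesgue. g x) =
      (\<Sum>i\<in>{1..N_I d}. LINT x:psu d i|lebesgue. g x)"
    using part by (intro set_integral_finite_Union) auto
  then show ?thesis
    using part(1) by simp
qed

lemma \<sigma>_nonneg: "0 \<le> \<sigma> i"
  by (auto simp: set_lebesgue_integral_def intro!: integral_nonneg_AE)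

lemma density:
  assumes "i \<in> {1..N_I d}"
  shows "f_II d i \<in> borel_measurable lebesgue" "\<And>x. 0 \<le> f_II d i x"
    "\<And>x. x \<notin> psu d i \<Longrightarrow> f_II d i x = 0"
  using sampling assms by (auto simp: two_stage_sampling_def second_stage_densities_def)

lemma weighted_value_measurable:
  assumes "i \<in> {1..N_I d}"
  shows "(\<lambda>x. \<rho> x / pi_II d i x) \<in> borel_measurable lebesgue"
  unfolding pi_II_def
  by (rule borel_measurable_inverse_density[OF _ _ set_integrable_psu(1)[OF assms]])
    (use density[OF assms] in auto)

lemma distributed_point:
  assumes "0 < prob (selected s)" "i \<in> s" "k < n_II d i"
  shows "distributed (given_sample d s) lebesgue (point d i k) (\<lambda>x. ennreal (f_II d i x))"
  using sampling assms by (auto simp: two_stage_sampling_def second_stage_def)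

section \<open>Moments given the first-stage sample\<close>

context
  fixes s assumes s: "0 < prob (selected s)"
begin

interpretation G: prob_space "given_sample d s"
  using s by (rule given_sample_prob_space)

text \<open>Since \<open>pi_II\<close> is \<open>n_II\<close> times the density, these are the
  moments of inverse density weighting after rescaling. The last claim is a deterministic
  Cauchy-Schwarz inequality, obtained from the nonnegative variance of \<open>\<rho>\<close> over
  the density at one sampled point.\<close>

lemma point_moments:
  assumes i: "i \<in> s" and k: "k < n_II d i"
  shows "G.expectation (\<lambda>w. \<rho> (point d i k w) / pi_II d i (point d i k w)) = \<tau> i / n_II d i"
    and "integrable (given_sample d s) (\<lambda>w. (\<rho> (point d i k w) / pi_II d i (point d i k w))\<^sup>2)"
    and "G.expectation (\<lambda>w. (\<rho> (point d i k w) / pi_II d i (point d i k w))\<^sup>2)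
      \<le> \<sigma> i / a / (n_II d i)\<^sup>2"
    and "(\<tau> i)\<^sup>2 \<le> \<sigma> i / a"
proof -
  let ?f = "f_II d i" and ?X = "point d i k"
  have i': "i \<in> {1..N_I d}"
    using possible_sample_subset[OF s] i by auto
  note X = distributed_point[OF s i k]
  note m = inverse_density_weighting[OF X density[OF i'] a(1) a(2)[OF i'] set_integrable_psu[OF i']]
  have eq: "(\<lambda>w. \<rho> (?X w) / pi_II d i (?X w)) = (\<lambda>w. \<rho> (?X w) / ?f (?X w) / n_II d i)"
    by (simp add: pi_II_def fun_eq_iff mult.commute)
  show "G.expectation (\<lambda>w. \<rho> (?X w) / pi_II d i (?X w)) = \<tau> i / n_II d i"
    unfolding eq integral_divide_zero using m(1) by (rule arg_cong)
  have eq2: "(\<rho> (?X w) / pi_II d i (?X w))\<^sup>2 = (\<rho> (?X w) / ?f (?X w))\<^sup>2 / (n_II d i)\<^sup>2" for w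
    by (simp add: pi_II_def power_divide power_mult_distrib mult.commute)
  show "integrable (given_sample d s) (\<lambda>w. (\<rho> (?X w) / pi_II d i (?X w))\<^sup>2)"
    unfolding eq2 by (rule integrable_divide_zero) (use m(2) in simp)
  show "G.expectation (\<lambda>w. (\<rho> (?X w) / pi_II d i (?X w))\<^sup>2) \<le> \<sigma> i / a / (n_II d i)\<^sup>2"
    unfolding eq2 integral_divide_zero by (rule divide_right_mono[OF m(3)]) auto
  have "(\<lambda>w. \<rho> (?X w) / ?f (?X w)) \<in> borel_measurable (given_sample d s)"
    using borel_measurable_inverse_density[OF density(1,3)[OF i'] set_integrable_psu(1)[OF i']]
      distributed_measurable[OF X] by (rule measurable_compose[rotated])
  then have "integrable (given_sample d s) (\<lambda>w. \<rho> (?X w) / ?f (?X w))"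
    using m(2) by (rule G.square_integrable_imp_integrable)
  from G.variance_eq[OF this m(2)]
  have "(G.expectation (\<lambda>w. \<rho> (?X w) / ?f (?X w)))\<^sup>2 \<le> G.expectation (\<lambda>w. (\<rho> (?X w) / ?f (?X w))\<^sup>2)"
    using G.variance_positive[of "\<lambda>w. \<rho> (?X w) / ?f (?X w)"] by simp
  then show "(\<tau> i)\<^sup>2 \<le> \<sigma> i / a"
    using m(1,3) by simp
qed

text \<open>Given \<open>s\<close>, the estimator is a single sum over pairs of a PSU and a draw,
  with independent terms, so variances add. The \<open>n_II d i\<close> terms of a PSU each carry a
  factor \<open>1 / (n_II d i)\<^sup>2\<close>; their sum keeps a factor
  \<open>1 / n_II d i\<close>, which is at most 1 and is dropped.\<close>

lemma HT_of_moments: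
  shows "integrable (given_sample d s) (HT_of s)"
    and "integrable (given_sample d s) (\<lambda>w. (HT_of s w)\<^sup>2)"
    and "G.expectation (HT_of s) = (\<Sum>i\<in>s. \<tau> i / pi_I d i)"
    and "G.variance (HT_of s) \<le> (\<Sum>i\<in>s. \<sigma> i / a / (pi_I d i)\<^sup>2)"
proof -
  define Y where "Y = (\<lambda>(i, k) w. \<rho> (point d i k w) / pi_II d i (point d i k w) / pi_I d i)"
  let ?I = "SIGMA i:s. {..<n_II d i}"
  have sub: "s \<subseteq> {1..N_I d}" and fin: "finite s" "finite ?I"
    using possible_sample_subset[OF s] by (auto intro: finite_subset)
  have sum_I: "(\<Sum>i\<in>s. \<Sum>k<n_II d i. h i k) = (\<Sum>j\<in>?I. h (fst j) (snd j))"
    for h :: "nat \<Rightarrow> nat \<Rightarrow> real"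
    using fin by (subst sum.Sigma) (auto simp: case_prod_beta')
  have HT_Y: "HT_of s = (\<lambda>w. \<Sum>j\<in>?I. Y j w)"
    unfolding HT_of_def psu_estimator_def Y_def
    by (simp add: sum_divide_distrib case_prod_beta' sum_I)
  have "G.indep_vars (\<lambda>_. lebesgue) (\<lambda>(i, k). point d i k) ?I"
    using sampling s by (auto simp: two_stage_sampling_def second_stage_def)
  \<comment> \<open>Each term is a measurable function of its own point, so independence carries
    over.\<close>
  then have "G.indep_vars (\<lambda>_. borel)
      (\<lambda>j w. \<rho> ((case j of (i, k) \<Rightarrow> point d i k) w) / pi_II d (fst j) ((case j of (i, k) \<Rightarrow> point d i k) w)
        / pi_I d (fst j)) ?I"
    by (rule G.indep_vars_compose2)
      (use sub in \<open>auto simp del: divide_divide_eq_left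
        intro!: borel_measurable_divide weighted_value_measurable\<close>)
  then have ind: "G.indep_vars (\<lambda>_. borel) Y ?I"
    by (simp add: Y_def case_prod_beta')
  have Y2: "integrable (given_sample d s) (\<lambda>w. (Y j w)\<^sup>2)"
    and VY: "G.variance (Y j) \<le> \<sigma> (fst j) / a / (pi_I d (fst j))\<^sup>2 / n_II d (fst j) / n_II d (fst j)"
    and EY: "G.expectation (Y j) = \<tau> (fst j) / pi_I d (fst j) / n_II d (fst j)"
    and Y1: "integrable (given_sample d s) (Y j)" if j: "j \<in> ?I" for j
  proof -
    obtain i k where j_eq: "j = (i, k)" and ik: "i \<in> s" "k < n_II d i"
      using j by auto
    note m = point_moments[OF ik]
    have sq: "(Y j w)\<^sup>2 = (\<rho> (point d i k w) / pi_II d i (point d i k w))\<^sup>2 / (pi_I d i)\<^sup>2" for w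
      by (simp add: Y_def j_eq power_divide power_mult_distrib)
    show i2: "integrable (given_sample d s) (\<lambda>w. (Y j w)\<^sup>2)"
      unfolding sq by (rule integrable_divide_zero) (use m(2) in simp)
    have "Y j \<in> borel_measurable (given_sample d s)"
      using ind j by (auto simp: G.indep_vars_def2)
    then show i1: "integrable (given_sample d s) (Y j)"
      using i2 by (rule G.square_integrable_imp_integrable)
    show "G.expectation (Y j) = \<tau> (fst j) / pi_I d (fst j) / n_II d (fst j)"
      using arg_cong[OF m(1), of "\<lambda>y. y / pi_I d i"]
      by (simp add: Y_def j_eq mult.commute flip: integral_divide_zero)
    have "G.variance (Y j) \<le> G.expectation (\<lambda>w. (Y j w)\<^sup>2)"
      using G.variance_eq[OF i1 i2] by simp
    also have "\<dots> \<le> \<sigma> i / a / (n_II d i)\<^sup>2 / (pi_I d i)\<^sup>2"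
      unfolding sq integral_divide_zero by (rule divide_right_mono[OF m(3)]) simp
    finally show "G.variance (Y j)
        \<le> \<sigma> (fst j) / a / (pi_I d (fst j))\<^sup>2 / n_II d (fst j) / n_II d (fst j)"
      by (simp add: j_eq power2_eq_square mult_ac)
  qed
  have n1: "1 \<le> real (n_II d i)" if "i \<in> s" for i
    using n_II[of i] sub that by (auto simp: Suc_le_eq)
  show "integrable (given_sample d s) (HT_of s)"
    unfolding HT_Y using Y1 by (rule Bochner_Integration.integrable_sum)
  show "integrable (given_sample d s) (\<lambda>w. (HT_of s w)\<^sup>2)"
    unfolding HT_Y using fin(2) ind Y2 by (rule G.integrable_indep_sum_square)
  have "G.expectation (HT_of s) = (\<Sum>j\<in>?I. \<tau> (fst j) / pi_I d (fst j) / n_II d (fst j))"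
    unfolding HT_Y using Y1 EY by (simp add: Bochner_Integration.integral_sum)
  also have "\<dots> = (\<Sum>i\<in>s. \<Sum>k<n_II d i. \<tau> i / pi_I d i / n_II d i)"
    by (rule sum_I[symmetric])
  also have "\<dots> = (\<Sum>i\<in>s. \<tau> i / pi_I d i)"
    using n1 by (intro sum.cong refl) force
  finally show "G.expectation (HT_of s) = (\<Sum>i\<in>s. \<tau> i / pi_I d i)" .
  have "G.variance (HT_of s) = (\<Sum>j\<in>?I. G.variance (Y j))"
    unfolding HT_Y using fin(2) ind Y2 by (rule G.variance_indep_sum)
  also have "\<dots> \<le> (\<Sum>j\<in>?I. \<sigma> (fst j) / a / (pi_I d (fst j))\<^sup>2 / n_II d (fst j) / n_II d (fst j))"
    by (rule sum_mono) (rule VY)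
  also have "\<dots> = (\<Sum>i\<in>s. \<Sum>k<n_II d i. \<sigma> i / a / (pi_I d i)\<^sup>2 / n_II d i / n_II d i)"
    by (rule sum_I[symmetric])
  also have "\<dots> \<le> (\<Sum>i\<in>s. \<sigma> i / a / (pi_I d i)\<^sup>2)"
  proof (rule sum_mono)
    fix i assume "i \<in> s"
    then have "(\<Sum>k<n_II d i. \<sigma> i / a / (pi_I d i)\<^sup>2 / n_II d i / n_II d i)
        = \<sigma> i / a / (pi_I d i)\<^sup>2 / n_II d i"
      using n1 by force
    also have "\<dots> \<le> \<sigma> i / a / (pi_I d i)\<^sup>2"
      using frac_le[OF _ order_refl zero_less_one n1[OF \<open>i \<in> s\<close>], of "\<sigma> i / a / (pi_I d i)\<^sup>2"]
        \<sigma>_nonneg[of i] a(1) by simp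
    finally show "(\<Sum>k<n_II d i. \<sigma> i / a / (pi_I d i)\<^sup>2 / n_II d i / n_II d i)
        \<le> \<sigma> i / a / (pi_I d i)\<^sup>2" .
  qed
  finally show "G.variance (HT_of s) \<le> (\<Sum>i\<in>s. \<sigma> i / a / (pi_I d i)\<^sup>2)" .
qed

end

section \<open>Inclusion indicators and measurability of the estimator\<close>

lemma I_I_measurable: "I_I d i \<in> borel_measurable (pspace d)"
  unfolding I_I_def by (rule measurable_compose[OF S_I_measurable]) simp

lemma I_I_integrable: "integrable (pspace d) (I_I d i)"
  by (rule integrable_const_bound[where B = 1]) (auto simp: I_I_def I_I_measurable indicator_def)

text \<open>A sum over a random index set becomes one over a fixed set, so that measurability and
  expectations can be treated term by term.\<close>

lemma sum_sample:
  fixes h :: "nat \<Rightarrow> real"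
  assumes "w \<in> space (pspace d)"
  shows "(\<Sum>i\<in>S_I d w. h i) = (\<Sum>i\<in>{1..N_I d}. I_I d i w * h i)"
proof -
  have "S_I d w \<subseteq> {1..N_I d}"
    using measurable_space[OF S_I_measurable assms] by simp
  then have "(\<Sum>i\<in>S_I d w. h i) = (\<Sum>i\<in>{1..N_I d}. if i \<in> S_I d w then h i else 0)"
    using sum.inter_restrict[of "{1..N_I d}" h "S_I d w"] by (simp only: Int_absorb1 finite_atLeastAtMost)
  also have "\<dots> = (\<Sum>i\<in>{1..N_I d}. I_I d i w * h i)"
    by (intro sum.cong refl) (auto simp: I_I_def)
  finally show ?thesis .
qed

text \<open>Otherwise \<open>i\<close> would lie only in samples of probability zero. There are
  finitely many of these, so \<open>i\<close> would almost surely not be selected, against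
  \<open>p \<le> pi_I d i\<close>.\<close>

lemma possible_sample_containing:
  assumes i: "i \<in> {1..N_I d}"
  obtains s where "0 < prob (selected s)" "i \<in> s"
proof (rule ccontr)
  assume "\<not> thesis"
  then have null: "selected s \<in> null_sets (pspace d)" if "s \<subseteq> {1..N_I d}" "i \<in> s" for s
  proof -
    have "\<not> 0 < prob (selected s)"
      using that \<open>\<not> thesis\<close> \<open>\<And>s. 0 < prob (selected s) \<Longrightarrow> i \<in> s \<Longrightarrow> thesis\<close> by blast
    then show ?thesis
      using selected_event[OF that(1)] by (simp add: null_sets_def emeasure_eq_measure zero_less_measure_iff)
  qed
  have "(\<Union>s\<in>{s. s \<subseteq> {1..N_I d} \<and> i \<in> s}. selected s) \<in> null_sets (pspace d)"
    by (rule null_sets.finite_UN) (use null in \<open>auto simp del: One_nat_def\<close>)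
  then have "AE w in pspace d. w \<notin> (\<Union>s\<in>{s. s \<subseteq> {1..N_I d} \<and> i \<in> s}. selected s)"
    by (rule AE_not_in)
  with AE_space have "AE w in pspace d. I_I d i w = 0"
  proof eventually_elim
    case (elim w)
    then show ?case
      using measurable_space[OF S_I_measurable, of w] by (auto simp: I_I_def indicator_def)
  qed
  then have "pi_I d i = 0"
    unfolding pi_I_def by (rule integral_eq_zero_AE)
  then show False
    using p(1) p(2)[OF i] by simp
qed

text \<open>The inequality was derived inside a possible sample containing \<open>i\<close>, but
  does not mention it; as such a sample exists for every PSU, it holds in general.\<close>

lemma \<tau>_square_le: "i \<in> {1..N_I d} \<Longrightarrow> (\<tau> i)\<^sup>2 \<le> \<sigma> i / a"
  by (rule possible_sample_containing) (auto intro!: point_moments(4) n_II simp del: One_nat_def)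

lemma HT_eq: "HT \<rho> d w = HT_of (S_I d w) w"
  by (simp add: HT_def HT_of_def)

text \<open>
  The sampling assumptions say something about \<open>point d i k\<close> only given samples of positive
  probability; since \<open>pi_I d i > 0\<close>, one of them contains \<open>i\<close>, which makes \<open>point d i k\<close> measurable on
  the whole space.
\<close>

lemma HT_measurable: "HT \<rho> d \<in> borel_measurable (pspace d)"
proof -
  have "(\<lambda>w. \<Sum>i\<in>{1..N_I d}. I_I d i w * (psu_estimator \<rho> d i w / pi_I d i))
      \<in> borel_measurable (pspace d)"
  proof (intro borel_measurable_sum borel_measurable_times borel_measurable_divide
      borel_measurable_const I_I_measurable)
    fix i assume i: "i \<in> {1..N_I d}"
    then obtain s where s: "0 < prob (selected s)" "i \<in> s"
      by (rule possible_sample_containing)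
    have "point d i k \<in> measurable (pspace d) lebesgue" if "k < n_II d i" for k
      using distributed_measurable[OF distributed_point[OF s that]]
      by (simp add: given_sample_def)
    then show "psu_estimator \<rho> d i \<in> borel_measurable (pspace d)"
      unfolding psu_estimator_def
      by (intro borel_measurable_sum) (auto intro: measurable_compose[OF _ weighted_value_measurable[OF i]])
  qed
  then show ?thesis
    by (rule measurable_cong[THEN iffD1, rotated]) (simp add: HT_def sum_sample)
qed

section \<open>Unbiasedness\<close>

lemmas condition_on_sample =
  conditioning_on_finite[OF S_I_measurable finite_Pow_iff[THEN iffD2, OF finite_atLeastAtMost],
    folded given_sample_def]

text \<open>Writing \<open>\<tau> i\<close> as \<open>pi_I d i * (\<tau> i / pi_I d i)\<close> and
  adding up the PSU integrals to that over \<open>F\<close> makes the first-stage error linear in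
  the centred indicators.\<close>

lemma sampled_total:
  assumes "w \<in> space (pspace d)"
  shows "(\<Sum>i\<in>S_I d w. \<tau> i / pi_I d i) - F_total F \<rho>
    = (\<Sum>i\<in>{1..N_I d}. (I_I d i w - pi_I d i) * (\<tau> i / pi_I d i))"
proof -
  have "pi_I d i * (\<tau> i / pi_I d i) = \<tau> i" if "i \<in> {1..N_I d}" for i
    using p that by force
  then have "(\<Sum>i\<in>{1..N_I d}. pi_I d i * (\<tau> i / pi_I d i)) = F_total F \<rho>"
    using sum_psu_integral[OF integrable(1)] by (simp add: F_total_def)
  then show ?thesis
    by (simp add: sum_sample[OF assms] left_diff_distrib sum_subtractf del: times_divide_eq_right)
qed

text \<open>Conditioning on the sample replaces each PSU estimator by \<open>\<tau> i\<close>. What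
  is left is a linear combination of centred indicators, whose expectation is zero.\<close>

lemma HT_unbiased:
  shows "integrable (pspace d) (HT \<rho> d)" and "expectation (HT \<rho> d) = F_total F \<rho>"
proof -
  have meas: "(\<lambda>w. HT_of (S_I d w) w) \<in> borel_measurable (pspace d)"
    using HT_measurable by (simp add: HT_eq[abs_def])
  show "integrable (pspace d) (HT \<rho> d)"
    unfolding HT_eq[abs_def] using meas HT_of_moments(1) by (rule condition_on_sample(1))
  have "expectation (HT \<rho> d) = expectation (\<lambda>w. \<Sum>i\<in>S_I d w. \<tau> i / pi_I d i)"
    unfolding HT_eq[abs_def] using meas HT_of_moments(1,3) by (rule condition_on_sample(2))
  also have "\<dots> = expectation (\<lambda>w. F_total F \<rho> + (\<Sum>i\<in>{1..N_I d}. (I_I d i w - pi_I d i) * (\<tau> i / pi_I d i)))"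
    by (intro Bochner_Integration.integral_cong refl) (subst sampled_total[symmetric], assumption, simp)
  also have "\<dots> = F_total F \<rho>"
  proof -
    have c: "integrable (pspace d) (\<lambda>w. I_I d i w - pi_I d i)"
        "expectation (\<lambda>w. I_I d i w - pi_I d i) = 0" for i
      using I_I_integrable[of i] by (simp_all add: prob_space flip: pi_I_def)
    show ?thesis
      using c(1) by (subst Bochner_Integration.integral_add)
        (simp_all add: prob_space c(2) del: times_divide_eq_right)
  qed
  finally show "expectation (HT \<rho> d) = F_total F \<rho>" .
qed

section \<open>Mean square error for a fixed design\<close>

text \<open>An indicator equals its square, so its variance is
  \<open>pi_I d i - (pi_I d i)\<^sup>2\<close>.\<close>

lemma I_I_variance_le: "expectation (\<lambda>w. (I_I d i w - pi_I d i)\<^sup>2) \<le> pi_I d i"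
proof -
  have "(I_I d i w)\<^sup>2 = I_I d i w" for w
    by (simp add: I_I_def indicator_def)
  then show ?thesis
    using variance_eq[OF I_I_integrable, of i] I_I_integrable[of i] by (simp add: pi_I_def)
qed

lemma I_I_covariance_le:
  assumes "i \<in> {1..N_I d}" "j \<in> {1..N_I d}" "i \<noteq> j"
  shows "\<bar>expectation (\<lambda>w. (I_I d i w - pi_I d i) * (I_I d j w - pi_I d j))\<bar> \<le> Delta_I 2 d"
proof -
  have "\<bar>expectation (\<lambda>w. \<Prod>l\<in>{i, j}. (I_I d l w - pi_I d l))\<bar> \<le> Delta_I 2 d"
    unfolding Delta_I_def
  proof (rule Max_ge)
    show "\<bar>expectation (\<lambda>w. \<Prod>l\<in>{i, j}. (I_I d l w - pi_I d l))\<bar> \<in> insert 0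
        ((\<lambda>J. \<bar>expectation (\<lambda>w. \<Prod>l\<in>J. (I_I d l w - pi_I d l))\<bar>) ` {J. J \<subseteq> {1..N_I d} \<and> card J = 2})"
      by (rule insertI2, rule imageI) (use assms in auto)
  qed simp
  then show ?thesis
    using assms(3) by simp
qed

lemma Delta_I_nonneg: "0 \<le> Delta_I k d"
  unfolding Delta_I_def by (intro Max_ge) (auto simp: finite_subset)

text \<open>Expanding the square gives a double sum. Its diagonal is controlled by the variances of
  the indicators and the rest by \<open>Delta_I 2 d\<close>; Cauchy-Schwarz then turns the squared
  sum of \<open>\<bar>t i\<bar>\<close> into \<open>N_I d\<close> times the sum of squares.\<close>

lemma sampled_total_second_moment_le:
  shows "integrable (pspace d) (\<lambda>w. (\<Sum>i\<in>{1..N_I d}. (I_I d i w - pi_I d i) * t i)\<^sup>2)"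
    and "expectation (\<lambda>w. (\<Sum>i\<in>{1..N_I d}. (I_I d i w - pi_I d i) * t i)\<^sup>2)
      \<le> (\<Sum>i\<in>{1..N_I d}. pi_I d i * (t i)\<^sup>2) + Delta_I 2 d * real (N_I d) * (\<Sum>i\<in>{1..N_I d}. (t i)\<^sup>2)"
proof -
  define J where "J i w = I_I d i w - pi_I d i" for i w
  let ?N = "{1..N_I d}"
  have sq: "(\<Sum>i\<in>?N. J i w * t i)\<^sup>2 = (\<Sum>i\<in>?N. \<Sum>j\<in>?N. J i w * J j w * (t i * t j))" for w
    unfolding power2_eq_square sum_product by (intro sum.cong refl) (simp add: mult_ac)
  have int: "integrable (pspace d) (\<lambda>w. J i w * J j w)" for i j
  proof (rule integrable_const_bound)
    have "\<bar>J i w\<bar> \<le> 1 + \<bar>pi_I d i\<bar>" for i w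
      by (auto simp: J_def I_I_def indicator_def)
    then show "AE w in pspace d. norm (J i w * J j w) \<le> (1 + \<bar>pi_I d i\<bar>) * (1 + \<bar>pi_I d j\<bar>)"
      by (auto simp: abs_mult intro!: mult_mono)
    show "(\<lambda>w. J i w * J j w) \<in> borel_measurable (pspace d)"
      unfolding J_def using I_I_measurable by measurable
  qed
  show "integrable (pspace d) (\<lambda>w. (\<Sum>i\<in>?N. (I_I d i w - pi_I d i) * t i)\<^sup>2)"
    unfolding J_def[symmetric] sq using int by simp
  have "expectation (\<lambda>w. (\<Sum>i\<in>?N. J i w * t i)\<^sup>2)
      = (\<Sum>i\<in>?N. \<Sum>j\<in>?N. expectation (\<lambda>w. J i w * J j w) * (t i * t j))"
    unfolding sq using int by simp
  \<comment> \<open>The nonnegative \<open>Delta_I\<close> term is added on the diagonal as well, so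
    that the products \<open>\<bar>t i\<bar> * \<bar>t j\<bar>\<close> sum to a full square.\<close>
  also have "\<dots> \<le> (\<Sum>i\<in>?N. \<Sum>j\<in>?N.
      (if i = j then pi_I d i * (t i)\<^sup>2 else 0) + Delta_I 2 d * (\<bar>t i\<bar> * \<bar>t j\<bar>))"
  proof (intro sum_mono)
    fix i j assume ij: "i \<in> ?N" "j \<in> ?N"
    show "expectation (\<lambda>w. J i w * J j w) * (t i * t j)
        \<le> (if i = j then pi_I d i * (t i)\<^sup>2 else 0) + Delta_I 2 d * (\<bar>t i\<bar> * \<bar>t j\<bar>)"
    proof (cases "i = j")
      case True
      have "expectation (\<lambda>w. J i w * J j w) * (t i * t j) \<le> pi_I d i * (t i)\<^sup>2"
        using I_I_variance_le[of i] True
        by (simp add: J_def power2_eq_square mult_right_mono)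
      also have "\<dots> \<le> pi_I d i * (t i)\<^sup>2 + Delta_I 2 d * (\<bar>t i\<bar> * \<bar>t j\<bar>)"
        using Delta_I_nonneg[of 2] by simp
      finally show ?thesis
        using True by simp
    next
      case False
      have "expectation (\<lambda>w. J i w * J j w) * (t i * t j)
          \<le> \<bar>expectation (\<lambda>w. J i w * J j w)\<bar> * (\<bar>t i\<bar> * \<bar>t j\<bar>)"
        by (metis abs_ge_self abs_mult)
      also have "\<dots> \<le> Delta_I 2 d * (\<bar>t i\<bar> * \<bar>t j\<bar>)"
        using I_I_covariance_le[OF ij False] by (intro mult_right_mono) (auto simp: J_def)
      finally show ?thesis
        using False by simp
    qed
  qed
  also have "\<dots> = (\<Sum>i\<in>?N. pi_I d i * (t i)\<^sup>2) + Delta_I 2 d * (\<Sum>i\<in>?N. \<bar>t i\<bar>)\<^sup>2"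
    by (simp add: sum.distrib power2_eq_square[of "sum _ _"] sum_product flip: sum_distrib_left)
  also have "\<dots> \<le> (\<Sum>i\<in>?N. pi_I d i * (t i)\<^sup>2) + Delta_I 2 d * ((\<Sum>i\<in>?N. (t i)\<^sup>2) * real (N_I d))"
    using sum_squared_le_sum_of_squares[of "\<lambda>i. \<bar>t i\<bar>" ?N] Delta_I_nonneg[of 2]
    by (intro add_left_mono mult_left_mono) auto
  finally show "expectation (\<lambda>w. (\<Sum>i\<in>?N. (I_I d i w - pi_I d i) * t i)\<^sup>2)
      \<le> (\<Sum>i\<in>?N. pi_I d i * (t i)\<^sup>2) + Delta_I 2 d * real (N_I d) * (\<Sum>i\<in>?N. (t i)\<^sup>2)"
    by (simp add: J_def mult_ac)
qed

text \<open>Given the sample, the mean square error is a variance plus a squared bias. The averaged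
  variance and the diagonal part of the first-stage error contribute \<open>1 / p\<close> each, the
  covariances of the indicators the \<open>Delta_I\<close> term.\<close>

lemma HT_second_moment:
  shows "integrable (pspace d) (\<lambda>w. (HT \<rho> d w - F_total F \<rho>)\<^sup>2)"
    and "expectation (\<lambda>w. (HT \<rho> d w - F_total F \<rho>)\<^sup>2)
      \<le> (LINT x:F|lebesgue. (\<rho> x)\<^sup>2) / a * (2 / p + Delta_I 2 d * real (N_I d) / p\<^sup>2)"
proof -
  let ?N = "{1..N_I d}" and ?T = "F_total F \<rho>"
  let ?v = "\<lambda>i. \<sigma> i / a / (pi_I d i)\<^sup>2" and ?t = "\<lambda>i. \<tau> i / pi_I d i"
  have meas: "(\<lambda>w. (HT_of (S_I d w) w - ?T)\<^sup>2) \<in> borel_measurable (pspace d)"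
    using HT_measurable unfolding HT_eq[abs_def] by measurable
  have int: "integrable (given_sample d s) (\<lambda>w. (HT_of s w - ?T)\<^sup>2)"
    and le: "(\<integral>w. (HT_of s w - ?T)\<^sup>2 \<partial>given_sample d s) \<le> (\<Sum>i\<in>s. ?v i) + ((\<Sum>i\<in>s. ?t i) - ?T)\<^sup>2"
    if s: "0 < prob (selected s)" for s
  proof -
    interpret G: prob_space "given_sample d s"
      using s by (rule given_sample_prob_space)
    note m = HT_of_moments[OF s]
    show "integrable (given_sample d s) (\<lambda>w. (HT_of s w - ?T)\<^sup>2)"
      using m(1,2) by (simp add: power2_diff)
    show "(\<integral>w. (HT_of s w - ?T)\<^sup>2 \<partial>given_sample d s) \<le> (\<Sum>i\<in>s. ?v i) + ((\<Sum>i\<in>s. ?t i) - ?T)\<^sup>2"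
      by (subst G.second_moment_about[OF m(1,2)]) (use m(4) in \<open>simp add: m(3)[symmetric]\<close>)
  qed
  show "integrable (pspace d) (\<lambda>w. (HT \<rho> d w - ?T)\<^sup>2)"
    unfolding HT_eq using meas int by (rule condition_on_sample(1)[where Z = "\<lambda>s w. (HT_of s w - ?T)\<^sup>2"])
  have "expectation (\<lambda>w. (HT \<rho> d w - ?T)\<^sup>2)
      \<le> expectation (\<lambda>w. (\<Sum>i\<in>S_I d w. ?v i) + ((\<Sum>i\<in>S_I d w. ?t i) - ?T)\<^sup>2)"
    unfolding HT_eq using meas int le
    by (rule condition_on_sample(3)[where Z = "\<lambda>s w. (HT_of s w - ?T)\<^sup>2"])
  also have "\<dots> = expectation (\<lambda>w. (\<Sum>i\<in>?N. I_I d i w * ?v i)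
      + (\<Sum>i\<in>?N. (I_I d i w - pi_I d i) * ?t i)\<^sup>2)"
    by (intro Bochner_Integration.integral_cong refl) (subst sampled_total, assumption, subst sum_sample, assumption, rule refl)
  also have "\<dots> = (\<Sum>i\<in>?N. pi_I d i * ?v i) + expectation (\<lambda>w. (\<Sum>i\<in>?N. (I_I d i w - pi_I d i) * ?t i)\<^sup>2)"
  proof (subst Bochner_Integration.integral_add)
    show "expectation (\<lambda>w. \<Sum>i\<in>?N. I_I d i w * ?v i) + expectation (\<lambda>w. (\<Sum>i\<in>?N. (I_I d i w - pi_I d i) * ?t i)\<^sup>2)
        = (\<Sum>i\<in>?N. pi_I d i * ?v i) + expectation (\<lambda>w. (\<Sum>i\<in>?N. (I_I d i w - pi_I d i) * ?t i)\<^sup>2)"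
      using I_I_integrable by (subst Bochner_Integration.integral_sum) (simp_all flip: pi_I_def)
  qed (simp add: I_I_integrable, rule sampled_total_second_moment_le(1))
  also have "\<dots> \<le> (\<Sum>i\<in>?N. pi_I d i * ?v i) + ((\<Sum>i\<in>?N. pi_I d i * (?t i)\<^sup>2)
      + Delta_I 2 d * real (N_I d) * (\<Sum>i\<in>?N. (?t i)\<^sup>2))"
    using sampled_total_second_moment_le(2)[of ?t] by (rule add_left_mono)
  also have "\<dots> \<le> (\<Sum>i\<in>?N. \<sigma> i / a / p) + ((\<Sum>i\<in>?N. \<sigma> i / a / p)
      + Delta_I 2 d * real (N_I d) * (\<Sum>i\<in>?N. \<sigma> i / a / p\<^sup>2))"
  proof -
    \<comment> \<open>In \<open>1\<close> one power of \<open>pi_I d i\<close> cancels, while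
      \<open>3\<close> retains both; hence \<open>p\<close> in one bound and
      \<open>p\<^sup>2\<close> in the other. Through \<open>\<tau>_square_le\<close>,
      \<open>2\<close> lets the first-stage diagonal share the bound of the variance part.\<close>
    have 1: "pi_I d i * ?v i \<le> \<sigma> i / a / p" and 2: "pi_I d i * (?t i)\<^sup>2 \<le> pi_I d i * ?v i"
      and 3: "(?t i)\<^sup>2 \<le> \<sigma> i / a / p\<^sup>2" if i: "i \<in> ?N" for i
    proof -
      have \<pi>: "0 < pi_I d i" "p \<le> pi_I d i"
        using p(1) p(2)[OF i] by auto
      have nn: "0 \<le> \<sigma> i / a"
        using \<sigma>_nonneg[of i] a(1) by simp
      have "pi_I d i * ?v i = \<sigma> i / a / pi_I d i"
        using \<pi> by (simp add: power2_eq_square)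
      also have "\<dots> \<le> \<sigma> i / a / p"
        using \<pi> nn p(1) by (intro divide_left_mono) auto
      finally show "pi_I d i * ?v i \<le> \<sigma> i / a / p" .
      have tv: "(?t i)\<^sup>2 \<le> ?v i"
        unfolding power_divide by (rule divide_right_mono[OF \<tau>_square_le[OF i]]) simp
      then show "pi_I d i * (?t i)\<^sup>2 \<le> pi_I d i * ?v i"
        using \<pi> by (intro mult_left_mono) auto
      have "?v i \<le> \<sigma> i / a / p\<^sup>2"
        using \<pi> nn p(1) by (intro divide_left_mono power_mono) auto
      with tv show "(?t i)\<^sup>2 \<le> \<sigma> i / a / p\<^sup>2"
        by (rule order_trans)
    qed
    show ?thesis
      using Delta_I_nonneg[of 2]
      by (intro add_mono mult_left_mono[OF sum_mono] sum_mono[OF 1] sum_mono[OF order_trans[OF 2 1]] 3) auto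
  qed
  also have "\<dots> = (LINT x:F|lebesgue. (\<rho> x)\<^sup>2) / a * (2 / p + Delta_I 2 d * real (N_I d) / p\<^sup>2)"
    unfolding sum_divide_distrib[symmetric] sum_psu_integral[OF integrable(2)]
    by (simp add: algebra_simps)
  finally show "expectation (\<lambda>w. (HT \<rho> d w - ?T)\<^sup>2)
      \<le> (LINT x:F|lebesgue. (\<rho> x)\<^sup>2) / a * (2 / p + Delta_I 2 d * real (N_I d) / p\<^sup>2)" .
qed

end


section \<open>From the assumptions to the asymptotic statements\<close>

text \<open>Nonnegativity of \<open>((f x)\<^sup>2 - 1)\<^sup>2\<close> bounds the square by
  \<open>1 + f x ^ 4\<close>, and constants are integrable on a set of finite measure. This is how
  \<open>VA1\<close> yields the second moment of \<open>\<rho>\<close>.\<close>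

lemma set_integrable_square_of_fourth_power:
  fixes f :: "'a \<Rightarrow> real"
  assumes A: "A \<in> sets M" "emeasure M A < \<infinity>"
    and f: "set_borel_measurable M A f" "set_integrable M A (\<lambda>x. f x ^ 4)"
  shows "set_integrable M A (\<lambda>x. (f x)\<^sup>2)"
proof (rule set_integrable_bound[where f = "\<lambda>x. 1 + f x ^ 4"])
  have "set_integrable M A (\<lambda>_. 1 :: real)"
    using A by (simp add: set_integrable_def)
  then show "set_integrable M A (\<lambda>x. 1 + f x ^ 4)"
    using f(2) by (rule set_integral_add)
  have "(\<lambda>x. (indicator A x *\<^sub>R f x)\<^sup>2) \<in> borel_measurable M"
    using f(1) unfolding set_borel_measurable_def by measurable
  also have "(\<lambda>x. (indicator A x *\<^sub>R f x)\<^sup>2) = (\<lambda>x. indicator A x *\<^sub>R (f x)\<^sup>2)"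
    by (auto simp: indicator_def fun_eq_iff)
  finally show "set_borel_measurable M A (\<lambda>x. (f x)\<^sup>2)"
    by (simp add: set_borel_measurable_def)
  have "(f x)\<^sup>2 \<le> 1 + f x ^ 4" for x
  proof -
    have "0 \<le> ((f x)\<^sup>2 - 1)\<^sup>2" "0 \<le> (f x)\<^sup>2"
      by auto
    moreover have "((f x)\<^sup>2 - 1)\<^sup>2 = f x ^ 4 - 2 * (f x)\<^sup>2 + 1"
      by (simp add: power2_eq_square algebra_simps power4_eq_xxxx)
    ultimately show ?thesis
      by linarith
  qed
  then show "AE x in M. x \<in> A \<longrightarrow> norm ((f x)\<^sup>2) \<le> norm (1 + f x ^ 4)"
    by (auto simp: abs_if intro!: AE_I2) (smt (verit) zero_le_power2)+
qed

theorem proposition2: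
  fixes F :: "'a::euclidean_space set"
    and \<rho> :: "'a \<Rightarrow> real"
    and D :: "nat \<Rightarrow> ('a, 'w) design"
  assumes "bounded F" and "F \<in> sets lebesgue" and "measure lebesgue F > 0"
    and "set_integrable lebesgue F \<rho>"
    and "\<And>\<nu>. two_stage_sampling F (D \<nu>)"
    and "asymptotic_frame D"
    and "FS1 D" and "FS2 D" and "SS1 F D" and "VA1 F \<rho>"
  shows "(\<forall>\<nu>. integrable (pspace (D \<nu>)) (HT \<rho> (D \<nu>)) \<and>
              (\<integral>w. HT \<rho> (D \<nu>) w \<partial>pspace (D \<nu>)) = F_total F \<rho>) \<and>
         (\<forall>\<nu>. integrable (pspace (D \<nu>))
                (\<lambda>w. ((HT \<rho> (D \<nu>) w - F_total F \<rho>) / measure lebesgue F)\<^sup>2)) \<and>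
         (\<lambda>\<nu>. \<integral>w. ((HT \<rho> (D \<nu>) w - F_total F \<rho>) / measure lebesgue F)\<^sup>2 \<partial>pspace (D \<nu>))
           \<in> O(\<lambda>\<nu>. 1 / real (n_I (D \<nu>))) \<and>
         converges_in_probability (\<lambda>\<nu>. pspace (D \<nu>)) (\<lambda>\<nu> w. HT \<rho> (D \<nu>) w / F_total F \<rho>) 1"
proof -
  define A where "A = measure lebesgue F"
  let ?T = "F_total F \<rho>"
  have A: "0 < A"
    using assms(3) by (simp add: A_def)
  obtain c C where c: "0 < c" "c \<le> C"
    and \<pi>: "\<And>\<nu> i. i \<in> {1..N_I (D \<nu>)} \<Longrightarrow> c \<le> real (N_I (D \<nu>)) / real (n_I (D \<nu>)) * pi_I (D \<nu>) i"
    using \<open>FS1 D\<close> unfolding FS1_def by metis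
  obtain C2 where C2: "0 < C2"
    "\<And>\<nu>. Delta_I 2 (D \<nu>) \<le> C2 * real (n_I (D \<nu>)) / real (N_I (D \<nu>)) ^ 2"
    using \<open>FS2 D\<close> unfolding FS2_def by metis
  obtain \<phi> \<Phi> b where ss: "0 < \<phi>" "\<phi> \<le> \<Phi>" "0 < b"
    and area: "\<And>\<nu> i. i \<in> {1..N_I (D \<nu>)} \<Longrightarrow> \<phi> * A / real (N_I (D \<nu>)) \<le> measure lebesgue (psu (D \<nu>) i)"
      "\<And>\<nu> i. i \<in> {1..N_I (D \<nu>)} \<Longrightarrow> measure lebesgue (psu (D \<nu>) i) \<le> \<Phi> * A / real (N_I (D \<nu>))"
    and dens: "\<And>\<nu> i x. i \<in> {1..N_I (D \<nu>)} \<Longrightarrow> x \<in> psu (D \<nu>) i \<Longrightarrow>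
      b / measure lebesgue (psu (D \<nu>) i) \<le> f_II (D \<nu>) i x"
    and n_II: "\<And>\<nu> i. i \<in> {1..N_I (D \<nu>)} \<Longrightarrow> 2 \<le> n_II (D \<nu>) i"
    using \<open>SS1 F D\<close> unfolding SS1_def A_def by metis
  have "emeasure lebesgue F < \<infinity>"
    using bounded_set_imp_lmeasurable[OF assms(1,2)] unfolding fmeasurable_def by blast
  moreover have "set_integrable lebesgue F (\<lambda>x. \<rho> x ^ 4)"
    using \<open>VA1 F \<rho>\<close> unfolding VA1_def by blast
  moreover have "set_borel_measurable lebesgue F \<rho>"
    using assms(4) by (auto simp: set_integrable_def set_borel_measurable_def)
  ultimately have \<rho>2: "set_integrable lebesgue F (\<lambda>x. (\<rho> x)\<^sup>2)"
    using assms(2) by (intro set_integrable_square_of_fourth_power)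
  have T: "?T \<noteq> 0"
    using \<open>VA1 F \<rho>\<close> unfolding VA1_def F_total_def by force

  \<comment> \<open>Without PSUs, \<open>F\<close> would be an empty union, contrary to its positive
    measure.\<close>
  have N: "0 < N_I (D \<nu>)" for \<nu>
  proof (rule ccontr)
    assume "\<not> 0 < N_I (D \<nu>)"
    then have "F = {}"
      using assms(5)[of \<nu>] by (auto simp: two_stage_sampling_def psu_partition_def)
    then show False
      using assms(3) by simp
  qed
  \<comment> \<open>For \<open>n_I = 0\<close> the convention \<open>x / 0 = 0\<close> would turn
    the lower bound of \<open>FS1\<close> at PSU 1 into \<open>c \<le> 0\<close>.\<close>
  have n: "0 < n_I (D \<nu>)" for \<nu>
    using \<pi>[of 1 \<nu>] N[of \<nu>] c(1) by (cases "n_I (D \<nu>) = 0") auto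
  \<comment> \<open>\<open>p\<close> is the lower bound of \<open>FS1\<close> solved for
    \<open>pi_I\<close>; \<open>a\<close> combines the lower density bound with the upper area bound
    of \<open>SS1\<close>. Inserting both and the \<open>FS2\<close> bound into the mean square
    error cancels every \<open>N_I\<close> and leaves \<open>K / n_I\<close>.\<close>
  define p where "p \<nu> = c * real (n_I (D \<nu>)) / real (N_I (D \<nu>))" for \<nu>
  define a where "a \<nu> = b * real (N_I (D \<nu>)) / (\<Phi> * A)" for \<nu>
  define R where "R = (LINT x:F|lebesgue. (\<rho> x)\<^sup>2)"
  define K where "K = R * \<Phi> * A / b * (2 / c + C2 / c\<^sup>2)"
  have R: "0 \<le> R"
    by (auto simp: R_def set_lebesgue_integral_def intro!: integral_nonneg_AE)
  have est: "two_stage_estimation F \<rho> (D \<nu>) (a \<nu>) (p \<nu>)" for \<nu>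
  proof
    show "two_stage_sampling F (D \<nu>)" "set_integrable lebesgue F \<rho>"
      "set_integrable lebesgue F (\<lambda>x. (\<rho> x)\<^sup>2)"
      by (fact assms \<rho>2)+
    show "0 < p \<nu>" "0 < a \<nu>"
      using c N[of \<nu>] n[of \<nu>] ss A by (auto simp: p_def a_def)
    fix i assume i: "i \<in> {1..N_I (D \<nu>)}"
    show "p \<nu> \<le> pi_I (D \<nu>) i"
      using \<pi>[OF i] N[of \<nu>] n[of \<nu>] by (simp add: p_def field_simps)
    show "0 < n_II (D \<nu>) i"
      using n_II[OF i] by simp
    fix x assume x: "x \<in> psu (D \<nu>) i"
    \<comment> \<open>Comparing the quotients below requires a positive denominator, which the lower
      area bound provides.\<close>
    have "0 < \<phi> * A / real (N_I (D \<nu>))"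
      using ss A N[of \<nu>] by simp
    then have pos: "0 < measure lebesgue (psu (D \<nu>) i)"
      using area(1)[OF i] by linarith
    have "a \<nu> = b / (\<Phi> * A / real (N_I (D \<nu>)))"
      by (simp add: a_def)
    also have "\<dots> \<le> b / measure lebesgue (psu (D \<nu>) i)"
      using area(2)[OF i] pos ss by (intro frac_le) auto
    also have "\<dots> \<le> f_II (D \<nu>) i x"
      by (rule dens[OF i x])
    finally show "a \<nu> \<le> f_II (D \<nu>) i x" .
  qed
  note unbiased = two_stage_estimation.HT_unbiased[OF est]
  note int2 = two_stage_estimation.HT_second_moment(1)[OF est]
  have mse: "(\<integral>w. (HT \<rho> (D \<nu>) w - ?T)\<^sup>2 \<partial>pspace (D \<nu>)) \<le> K / real (n_I (D \<nu>))" for \<nu>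
  proof -
    let ?n = "real (n_I (D \<nu>))" and ?N = "real (N_I (D \<nu>))"
    have nN: "0 < ?n" "0 < ?N"
      using n N by auto
    have "Delta_I 2 (D \<nu>) * ?N / (p \<nu>)\<^sup>2 \<le> (C2 * ?n / ?N\<^sup>2) * ?N / (p \<nu>)\<^sup>2"
      using C2(2)[of \<nu>] by (intro divide_right_mono mult_right_mono) auto
    then have "R / a \<nu> * (2 / p \<nu> + Delta_I 2 (D \<nu>) * ?N / (p \<nu>)\<^sup>2)
        \<le> R / a \<nu> * (2 / p \<nu> + (C2 * ?n / ?N\<^sup>2) * ?N / (p \<nu>)\<^sup>2)"
      using R ss A nN by (intro mult_left_mono add_left_mono) (auto simp: a_def)
    also have "\<dots> = K / ?n"
      using nN c(1) ss A by (simp add: K_def a_def p_def field_simps power2_eq_square)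
    finally show ?thesis
      using two_stage_estimation.HT_second_moment(2)[OF est, of \<nu>] by (simp add: R_def)
  qed
  have bigo: "(\<lambda>\<nu>. \<integral>w. ((HT \<rho> (D \<nu>) w - ?T) / A)\<^sup>2 \<partial>pspace (D \<nu>)) \<in> O(\<lambda>\<nu>. 1 / real (n_I (D \<nu>)))"
  proof (rule bigoI[of _ "K / A\<^sup>2"], rule always_eventually, rule allI)
    fix \<nu>
    have "0 \<le> (\<integral>w. (HT \<rho> (D \<nu>) w - ?T)\<^sup>2 \<partial>pspace (D \<nu>)) / A\<^sup>2"
      by simp
    moreover have "(\<integral>w. (HT \<rho> (D \<nu>) w - ?T)\<^sup>2 \<partial>pspace (D \<nu>)) / A\<^sup>2 \<le> K / real (n_I (D \<nu>)) / A\<^sup>2"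
      using mse by (rule divide_right_mono) simp
    ultimately show "norm (\<integral>w. ((HT \<rho> (D \<nu>) w - ?T) / A)\<^sup>2 \<partial>pspace (D \<nu>))
        \<le> K / A\<^sup>2 * norm (1 / real (n_I (D \<nu>)))"
      by (simp add: power_divide mult.commute)
  qed
  have conv: "converges_in_probability (\<lambda>\<nu>. pspace (D \<nu>)) (\<lambda>\<nu> w. HT \<rho> (D \<nu>) w / ?T) 1"
    unfolding converges_in_probability_def
  proof (intro conjI allI impI)
    fix \<nu>
    show "(\<lambda>w. HT \<rho> (D \<nu>) w / ?T) \<in> borel_measurable (pspace (D \<nu>))"
      using two_stage_estimation.HT_measurable[OF est] by (rule borel_measurable_divide) simp
  next
    fix e :: real assume e: "0 < e"
    have le: "measure (pspace (D \<nu>)) {w \<in> space (pspace (D \<nu>)). e < \<bar>HT \<rho> (D \<nu>) w / ?T - 1\<bar>}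
        \<le> K / (?T\<^sup>2 * e\<^sup>2) / real (n_I (D \<nu>))" for \<nu>
    proof -
      interpret prob_space "pspace (D \<nu>)"
        using assms(5) by (simp add: two_stage_sampling_def first_stage_def)
      let ?f = "\<lambda>w. HT \<rho> (D \<nu>) w - ?T"
      have f[measurable]: "?f \<in> borel_measurable (pspace (D \<nu>))"
        using two_stage_estimation.HT_measurable[OF est] by measurable
      \<comment> \<open>A relative error above \<open>e\<close> forces an absolute error of at least
        \<open>e * \<bar>?T\<bar>\<close>, a positive threshold to which Chebyshev's inequality
        applies.\<close>
      have "e * \<bar>?T\<bar> \<le> \<bar>?f w\<bar>" if "e < \<bar>HT \<rho> (D \<nu>) w / ?T - 1\<bar>" for w
      proof -
        have "?f w = (HT \<rho> (D \<nu>) w / ?T - 1) * ?T"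
          using T by (simp add: left_diff_distrib)
        then show ?thesis
          using that by (simp add: abs_mult mult_right_mono)
      qed
      then have "prob {w \<in> space (pspace (D \<nu>)). e < \<bar>HT \<rho> (D \<nu>) w / ?T - 1\<bar>}
          \<le> prob {w \<in> space (pspace (D \<nu>)). e * \<bar>?T\<bar> \<le> \<bar>?f w\<bar>}"
        by (intro finite_measure_mono) auto
      also have "\<dots> \<le> expectation (\<lambda>w. (?f w)\<^sup>2) / (e * \<bar>?T\<bar>)\<^sup>2"
        using f int2 e T by (intro second_moment_method) auto
      also have "\<dots> \<le> K / real (n_I (D \<nu>)) / (e * \<bar>?T\<bar>)\<^sup>2"
        using mse by (rule divide_right_mono) simp
      finally show ?thesis
        by (simp add: power_mult_distrib mult_ac)
    qed
    have "filterlim (\<lambda>\<nu>. real (n_I (D \<nu>))) at_top sequentially"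
      using \<open>asymptotic_frame D\<close> filterlim_compose[OF filterlim_real_sequentially]
      unfolding asymptotic_frame_def by blast
    then have "(\<lambda>\<nu>. K / (?T\<^sup>2 * e\<^sup>2) / real (n_I (D \<nu>))) \<longlonglongrightarrow> 0"
      by (intro tendsto_divide_0[OF tendsto_const] filterlim_at_top_imp_at_infinity)
    then show "(\<lambda>\<nu>. measure (pspace (D \<nu>)) {w \<in> space (pspace (D \<nu>)). e < \<bar>HT \<rho> (D \<nu>) w / ?T - 1\<bar>})
        \<longlonglongrightarrow> 0"
      by (rule tendsto_sandwich[OF _ _ tendsto_const, rotated -1]) (use le in \<open>auto intro!: always_eventually\<close>)
  qed
  show ?thesis
    using unbiased int2 bigo conv unfolding A_def by (simp add: power_divide)
qed

end
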